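(* Let $G$ be a group and $\sigma$ a collection of finite-index subgroups of $G$. Then the following are equivalent: (1) $\sigma$ is semi-conjugacy-separating. (2) For any finite subset $F\subset G$, there is $G_\alpha\in\sigma$ such that $\big(\bigcup_{k\in G}kG_\alpha k^{-1}\big)\cap F\subset\{1\}$. (3) For any finite subset $F\subset G$, there is $G_\alpha\in\sigma$ such that the quotient map $G\to G/G_\alpha$ (onto left cosets) is injective on $F\cdot k$ for every $k\in G$.
   Context: A family $\sigma$ of finite-index (not necessarily normal) subgroups of $G$ is semi-conjugacy-separating if for every non-empty finite subset $F\subset G$ there is $G_\alpha\in\sigma$ such that $G_\alpha\cap g^G G_\alpha=\varnothing$ for every $g\in F\setminus\{1\}$, where $g^G$ is the conjugacy class of $g$ and $g^G G_\alpha=\{xy: x\in g^G,\ y\in G_\alpha\}$. *)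

theory Defs
  imports "HOL-Algebra.Left_Coset"
begin

definition finite_index_subgroup :: "'a set \<Rightarrow> ('a, 'b) monoid_scheme \<Rightarrow> bool" where
  "finite_index_subgroup H G \<longleftrightarrow> subgroup H G \<and> finite (lcosets\<^bsub>G\<^esub> H)"

definition conj_class :: "('a, 'b) monoid_scheme \<Rightarrow> 'a \<Rightarrow> 'a set" where
  "conj_class G g = {k \<otimes>\<^bsub>G\<^esub> g \<otimes>\<^bsub>G\<^esub> inv\<^bsub>G\<^esub> k | k. k \<in> carrier G}"

(* The separation condition only: that every member of \<sigma> is a finite-index subgroup of G is
   a separate hypothesis wherever this predicate is used. *)
definition semi_conjugacy_separating :: "('a, 'b) monoid_scheme \<Rightarrow> 'a set set \<Rightarrow> bool" where
  "semi_conjugacy_separating G \<sigma> \<longleftrightarrow>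
     (\<forall>F. F \<subseteq> carrier G \<and> finite F \<and> F \<noteq> {} \<longrightarrow>
        (\<exists>H\<in>\<sigma>. \<forall>g\<in>F - {\<one>\<^bsub>G\<^esub>}. H \<inter> (conj_class G g <#>\<^bsub>G\<^esub> H) = {}))"

end

theory Submission
  imports Defs
begin

context group
begin

lemma mem_Union_conjugates_iff:
  assumes "subgroup H G" "g \<in> carrier G"
  shows "g \<in> (\<Union>k\<in>carrier G. (k <# H) #> inv k) \<longleftrightarrow> (\<exists>k\<in>carrier G. inv k \<otimes> g \<otimes> k \<in> H)"
proof
  assume "g \<in> (\<Union>k\<in>carrier G. (k <# H) #> inv k)"
  then obtain k h where k: "k \<in> carrier G" and h: "h \<in> H" and g: "g = k \<otimes> h \<otimes> inv k"
    by (auto simp: l_coset_def r_coset_def)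
  have "h \<in> carrier G"
    using h subgroup.mem_carrier[OF assms(1)] by blast
  then have "inv k \<otimes> g \<otimes> k = h"
    using k by (simp add: g m_assoc inv_solve_left')
  then show "\<exists>k\<in>carrier G. inv k \<otimes> g \<otimes> k \<in> H"
    using k h by auto
next
  assume "\<exists>k\<in>carrier G. inv k \<otimes> g \<otimes> k \<in> H"
  then obtain k where k: "k \<in> carrier G" and h: "inv k \<otimes> g \<otimes> k \<in> H"
    by blast
  have "g = k \<otimes> (inv k \<otimes> g \<otimes> k) \<otimes> inv k"
    using k assms(2) by (simp add: m_assoc) (simp add: m_assoc[symmetric])
  then show "g \<in> (\<Union>k\<in>carrier G. (k <# H) #> inv k)"
    using k h unfolding l_coset_def r_coset_def by blast
qed

lemma disjoint_conj_class_mult_iff: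
  assumes H: "subgroup H G" and g: "g \<in> carrier G"
  shows "H \<inter> (conj_class G g <#> H) = {} \<longleftrightarrow> g \<notin> (\<Union>k\<in>carrier G. (k <# H) #> inv k)"
proof -
  have "(\<exists>x. x \<in> H \<and> x \<in> conj_class G g <#> H) \<longleftrightarrow> (\<exists>k\<in>carrier G. inv k \<otimes> g \<otimes> k \<in> H)"
  proof
    assume "\<exists>x. x \<in> H \<and> x \<in> conj_class G g <#> H"
    then obtain k y where k: "k \<in> carrier G" and y: "y \<in> H" and z: "k \<otimes> g \<otimes> inv k \<otimes> y \<in> H"
      by (auto simp: conj_class_def set_mult_def)
    have "k \<otimes> g \<otimes> inv k \<otimes> y \<otimes> inv y \<in> H"
      using H y z by (meson subgroup.m_closed subgroup.m_inv_closed)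
    moreover have "y \<in> carrier G"
      using H y by (rule subgroup.mem_carrier)
    ultimately have "k \<otimes> g \<otimes> inv k \<in> H"
      using g k by (simp add: m_assoc)
    then show "\<exists>k\<in>carrier G. inv k \<otimes> g \<otimes> k \<in> H"
      using k by (intro bexI[of _ "inv k"]) auto
  next
    assume "\<exists>k\<in>carrier G. inv k \<otimes> g \<otimes> k \<in> H"
    then obtain k where k: "k \<in> carrier G" and h: "inv k \<otimes> g \<otimes> k \<in> H"
      by blast
    have "inv k \<otimes> g \<otimes> inv (inv k) \<in> conj_class G g"
      unfolding conj_class_def using k by blast
    then have "(inv k \<otimes> g \<otimes> k) \<otimes> \<one> \<in> conj_class G g <#> H"
      using k subgroup.one_closed[OF H] unfolding set_mult_def by auto
    then show "\<exists>x. x \<in> H \<and> x \<in> conj_class G g <#> H"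
      using h k g by auto
  qed
  then show ?thesis
    using mem_Union_conjugates_iff[OF assms] by blast
qed

lemma l_coset_eq_iff:
  assumes H: "subgroup H G" and x: "x \<in> carrier G" and y: "y \<in> carrier G"
  shows "x <# H = y <# H \<longleftrightarrow> inv x \<otimes> y \<in> H"
proof
  assume "x <# H = y <# H"
  moreover have "y \<in> y <# H"
    using y subgroup.one_closed[OF H] unfolding l_coset_def by force
  ultimately obtain h where h: "h \<in> H" "y = x \<otimes> h"
    unfolding l_coset_def by auto
  then show "inv x \<otimes> y \<in> H"
    using x subgroup.mem_carrier[OF H] by (metis inv_solve_left y)
next
  assume h: "inv x \<otimes> y \<in> H"
  have "y = x \<otimes> (inv x \<otimes> y)"
    using x y by (simp add: m_assoc[symmetric])
  then have "y \<in> x <# H"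
    using h unfolding l_coset_def by blast
  then show "x <# H = y <# H"
    using l_repr_independence x H by blast
qed

lemma translate_l_coset_eq_iff:
  assumes "subgroup H G" "x \<in> carrier G" "y \<in> carrier G" "k \<in> carrier G"
  shows "(x \<otimes> k) <# H = (y \<otimes> k) <# H \<longleftrightarrow> inv k \<otimes> (inv x \<otimes> y) \<otimes> k \<in> H"
  using assms by (simp add: l_coset_eq_iff inv_mult_group m_assoc)

lemma semi_conjugacy_separating_iff:
  assumes "\<And>H. H \<in> \<sigma> \<Longrightarrow> subgroup H G"
  shows "semi_conjugacy_separating G \<sigma> \<longleftrightarrow>
    (\<forall>F. F \<subseteq> carrier G \<and> finite F \<longrightarrow>
      (\<exists>H\<in>\<sigma>. (\<Union>k\<in>carrier G. (k <# H) #> inv k) \<inter> F \<subseteq> {\<one>}))"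
    (is "_ \<longleftrightarrow> (\<forall>F. _ \<longrightarrow> (\<exists>H\<in>\<sigma>. ?avoids H F))")
proof -
  have avoids: "(\<forall>g\<in>F - {\<one>}. H \<inter> (conj_class G g <#> H) = {}) \<longleftrightarrow> ?avoids H F"
    if "H \<in> \<sigma>" "F \<subseteq> carrier G" for H F
    using disjoint_conj_class_mult_iff[OF assms[OF that(1)]] that(2) by blast
  have sep: "semi_conjugacy_separating G \<sigma> \<longleftrightarrow>
      (\<forall>F. F \<subseteq> carrier G \<and> finite F \<and> F \<noteq> {} \<longrightarrow> (\<exists>H\<in>\<sigma>. ?avoids H F))"
    unfolding semi_conjugacy_separating_def by (intro all_cong bex_cong refl) (simp add: avoids)
  show ?thesis
  proof
    assume "semi_conjugacy_separating G \<sigma>"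
    show "\<forall>F. F \<subseteq> carrier G \<and> finite F \<longrightarrow> (\<exists>H\<in>\<sigma>. ?avoids H F)"
    proof (intro allI impI)
      fix F assume "F \<subseteq> carrier G \<and> finite F"
      then have "\<exists>H\<in>\<sigma>. ?avoids H (insert \<one> F)"
        using \<open>semi_conjugacy_separating G \<sigma>\<close>[unfolded sep, rule_format, of "insert \<one> F"] by simp
      then show "\<exists>H\<in>\<sigma>. ?avoids H F"
        by blast
    qed
  qed (simp add: sep)
qed

lemma avoids_conjugates_iff_inj_on_translates:
  assumes sub: "\<And>H. H \<in> \<sigma> \<Longrightarrow> subgroup H G"
  shows "(\<forall>F. F \<subseteq> carrier G \<and> finite F \<longrightarrow>
      (\<exists>H\<in>\<sigma>. (\<Union>k\<in>carrier G. (k <# H) #> inv k) \<inter> F \<subseteq> {\<one>})) \<longleftrightarrow>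
    (\<forall>F. F \<subseteq> carrier G \<and> finite F \<longrightarrow>
      (\<exists>H\<in>\<sigma>. \<forall>k\<in>carrier G. inj_on (\<lambda>x. x <# H) (F #> k)))"
    (is "?L \<longleftrightarrow> ?R")
proof
  assume L: ?L
  show ?R
  proof (intro allI impI)
    fix F assume F: "F \<subseteq> carrier G \<and> finite F"
    let ?D = "(\<lambda>(x, y). inv x \<otimes> y) ` (F \<times> F)"
    have "?D \<subseteq> carrier G \<and> finite ?D"
      using F by auto
    from L[rule_format, OF this]
    obtain H where H: "H \<in> \<sigma>" and D: "(\<Union>k\<in>carrier G. (k <# H) #> inv k) \<inter> ?D \<subseteq> {\<one>}"
      by (rule bexE)
    have "inj_on (\<lambda>x. x <# H) (F #> k)" if k: "k \<in> carrier G" for k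
    proof (rule inj_onI)
      fix a b assume "a \<in> F #> k" "b \<in> F #> k" and eq: "a <# H = b <# H"
      then obtain x y where xy: "x \<in> F" "y \<in> F" and ab: "a = x \<otimes> k" "b = y \<otimes> k"
        by (auto simp: r_coset_def)
      have c: "x \<in> carrier G" "y \<in> carrier G"
        using xy F by auto
      have "inv k \<otimes> (inv x \<otimes> y) \<otimes> k \<in> H"
        using eq translate_l_coset_eq_iff[OF sub[OF H] c k] by (simp add: ab)
      then have "inv x \<otimes> y \<in> (\<Union>k\<in>carrier G. (k <# H) #> inv k)"
        using c k by (subst mem_Union_conjugates_iff[OF sub[OF H]]) auto
      moreover have "inv x \<otimes> y \<in> ?D"
        using xy by auto
      ultimately have "inv x \<otimes> y \<in> {\<one>}"
        by (intro subsetD[OF D] IntI)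
      then have "y = x"
        using c inv_solve_left[of \<one> x y] by simp
      then show "a = b"
        by (simp add: ab)
    qed
    with H show "\<exists>H\<in>\<sigma>. \<forall>k\<in>carrier G. inj_on (\<lambda>x. x <# H) (F #> k)"
      by (intro bexI[of _ H] ballI)
  qed
next
  assume R: ?R
  show ?L
  proof (intro allI impI)
    fix F assume F: "F \<subseteq> carrier G \<and> finite F"
    then have "insert \<one> F \<subseteq> carrier G \<and> finite (insert \<one> F)"
      by auto
    from R[rule_format, OF this] obtain H where H: "H \<in> \<sigma>"
      and inj: "\<forall>k\<in>carrier G. inj_on (\<lambda>x. x <# H) (insert \<one> F #> k)"
      by (rule bexE)
    have "g = \<one>" if "g \<in> (\<Union>k\<in>carrier G. (k <# H) #> inv k)" "g \<in> F" for g
    proof -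
      have g: "g \<in> carrier G"
        using that F by auto
      from that(1)[unfolded mem_Union_conjugates_iff[OF sub[OF H] g]]
      obtain k where k: "k \<in> carrier G" and "inv k \<otimes> g \<otimes> k \<in> H"
        by (rule bexE)
      then have "(\<one> \<otimes> k) <# H = (g \<otimes> k) <# H"
        using translate_l_coset_eq_iff[OF sub[OF H] one_closed g k] g by simp
      moreover have "\<one> \<otimes> k \<in> insert \<one> F #> k" "g \<otimes> k \<in> insert \<one> F #> k"
        using that(2) unfolding r_coset_def by blast+
      ultimately have "\<one> \<otimes> k = g \<otimes> k"
        by (rule inj_onD[OF inj[rule_format, OF k]])
      then show "g = \<one>"
        using g k by simp
    qed
    then show "\<exists>H\<in>\<sigma>. (\<Union>k\<in>carrier G. (k <# H) #> inv k) \<inter> F \<subseteq> {\<one>}"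
      using H by blast
  qed
qed

end

theorem lemma3p12:
  fixes G :: "('a, 'b) monoid_scheme" (structure) and \<sigma> :: "'a set set"
  assumes "group G"
    and "\<forall>H\<in>\<sigma>. finite_index_subgroup H G"
  shows "(semi_conjugacy_separating G \<sigma> \<longleftrightarrow>
            (\<forall>F. F \<subseteq> carrier G \<and> finite F \<longrightarrow>
               (\<exists>H\<in>\<sigma>. (\<Union>k\<in>carrier G. (k <# H) #> inv k) \<inter> F \<subseteq> {\<one>})))
       \<and> ((\<forall>F. F \<subseteq> carrier G \<and> finite F \<longrightarrow>
               (\<exists>H\<in>\<sigma>. (\<Union>k\<in>carrier G. (k <# H) #> inv k) \<inter> F \<subseteq> {\<one>})) \<longleftrightarrow>
            (\<forall>F. F \<subseteq> carrier G \<and> finite F \<longrightarrow>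
               (\<exists>H\<in>\<sigma>. \<forall>k\<in>carrier G. inj_on (\<lambda>x. x <# H) (F #> k))))"
proof -
  have "subgroup H G" if "H \<in> \<sigma>" for H
    using assms(2) that by (simp add: finite_index_subgroup_def)
  then show ?thesis
    by (intro conjI group.semi_conjugacy_separating_iff[OF assms(1)]
      group.avoids_conjugates_iff_inj_on_translates[OF assms(1)])
qed

end
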